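(* Let $\sigma \colon [0,l] \to X_{\mathrm{valid}}$ be a path in $\Sigma$ with arc length $l$. Let $n \geq 1$ and let $0 = t_1 < t_2 < \cdots < t_n = l$ be a sequence of $n$ real numbers, and set $\delta_i := \delta(\sigma(t_i))$ for $i = 1, \dots, n$. Then the reciprocal clearance cost of $\sigma$ satisfies $$c(\sigma) \geq \sum_{i=1}^{n-1} \ln\left( \frac{\left( \delta_i + \delta_{i+1} + t_{i+1} - t_i \right)^2}{4\,\delta_i \delta_{i+1}} \right).$$
   Context: $X$ is a state space, taken to be a subset of a real normed vector space with norm $\|\cdot\|$. $X_{\mathrm{invalid}} \subseteq X$ is the (nonempty) subset of invalid states and $X_{\mathrm{valid}} := X \setminus X_{\mathrm{invalid}}$ is the subset of valid states. The clearance of a valid state is $\delta(\mathbf{x}) := \min_{\mathbf{x}' \in X_{\mathrm{invalid}}} \|\mathbf{x} - \mathbf{x}'\|$; it is assumed that this minimum is attained and is strictly positive for every valid state, so $\delta \colon X_{\mathrm{valid}} \to (0,\infty)$. A path is a continuous function $\sigma \colon [0,l] \to X_{\mathrm{valid}}$ with $0 \leq l < \infty$, parameterized by arc length: for all $0 \leq s \leq t \leq l$ the restriction of $\sigma$ to $[s,t]$ has length $t-s$ with respect to $\|\cdot\|$. The number $l$ is the arc length of $\sigma$. $\Sigma$ denotes the set of all such paths. The reciprocal clearance cost of $\sigma \in \Sigma$ is $c(\sigma) := \int_0^l \frac{1}{\delta(\sigma(t))}\,dt$. An empty sum is $0$. *)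

theory Defs
  imports "HOL-Analysis.Analysis"
begin

text \<open>
  Clearance is a minimum in the mathematics. It is written here as an infimum; that the minimum
  is attained (and positive) on the valid states is a hypothesis wherever it is used.
\<close>
definition clearance :: "'a::real_normed_vector set \<Rightarrow> 'a \<Rightarrow> real" where
  "clearance Xinv x = (INF x'\<in>Xinv. norm (x - x'))"

text \<open>
  Length as the supremum of the lengths of inscribed polygons. The vertices are given by
  sorted lists of parameters in \<open>{a..b}\<close>; such lists need not contain the endpoints and may have
  repetitions, which does not affect the supremum.
\<close>
definition curve_length :: "(real \<Rightarrow> 'a::real_normed_vector) \<Rightarrow> real \<Rightarrow> real \<Rightarrow> ereal" where
  "curve_length \<sigma> a b =
     (SUP ts \<in> {ts. sorted ts \<and> set ts \<subseteq> {a..b}}.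
        ereal (\<Sum>i<length ts - 1. norm (\<sigma> (ts ! Suc i) - \<sigma> (ts ! i))))"

text \<open>
  Membership in the set of paths. The domain \<open>{0..l}\<close> is not part of the function \<open>\<sigma>\<close>, so \<open>l\<close> is
  an explicit argument, and the values of \<open>\<sigma>\<close> outside \<open>{0..l}\<close> are irrelevant.
\<close>
definition arclength_path :: "'a::real_normed_vector set \<Rightarrow> real \<Rightarrow> (real \<Rightarrow> 'a) \<Rightarrow> bool" where
  "arclength_path Xvalid l \<sigma> \<longleftrightarrow>
     0 \<le> l \<and> continuous_on {0..l} \<sigma> \<and> \<sigma> ` {0..l} \<subseteq> Xvalid \<and>
     (\<forall>s t. 0 \<le> s \<and> s \<le> t \<and> t \<le> l \<longrightarrow> curve_length \<sigma> s t = ereal (t - s))"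

definition reciprocal_clearance_cost ::
    "'a::real_normed_vector set \<Rightarrow> real \<Rightarrow> (real \<Rightarrow> 'a) \<Rightarrow> real" where
  "reciprocal_clearance_cost Xinv l \<sigma> = integral {0..l} (\<lambda>t. 1 / clearance Xinv (\<sigma> t))"

end

theory Submission
  imports Defs
begin

text \<open>
  Along an arc-length parameterized path the clearance \<open>f\<close> is 1-Lipschitz in the parameter, so on
  \<open>[a, b]\<close> it lies below both \<open>f a + (x - a)\<close> and \<open>f b + (b - x)\<close>. These two lines meet at
  height \<open>(f a + f b + b - a) / 2\<close>; integrating the reciprocal of the lower one on either side of the
  meeting point gives exactly the logarithm in the bound.
\<close>

text \<open>Makes the library facts on \<open>infdist\<close> available for the clearance. By
  convention \<open>infdist\<close> is 0 for the empty set, hence the nonemptiness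
  hypothesis.\<close>

lemma clearance_eq_infdist:
  assumes "Xinv \<noteq> {}"
  shows "clearance Xinv x = infdist x Xinv"
  using assms by (simp add: clearance_def infdist_def dist_norm)

lemma clearance_lipschitz:
  assumes "Xinv \<noteq> {}"
  shows "1-lipschitz_on S (clearance Xinv)"
proof (rule lipschitz_onI)
  fix x y
  have "infdist x Xinv \<le> infdist y Xinv + dist x y" "infdist y Xinv \<le> infdist x Xinv + dist x y"
    using infdist_triangle[of x Xinv y] infdist_triangle[of y Xinv x] by (simp_all add: dist_commute)
  then show "dist (clearance Xinv x) (clearance Xinv y) \<le> 1 * dist x y"
    using assms by (simp add: clearance_eq_infdist dist_real_def abs_le_iff)
qed simp

text \<open>The chord is the inscribed polygon with vertex list \<open>[s, t]\<close>, one of the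
  competitors in the supremum.\<close>

lemma dist_le_curve_length:
  assumes "s \<le> t"
  shows "ereal (norm (\<sigma> t - \<sigma> s)) \<le> curve_length \<sigma> s t"
proof -
  have "[s, t] \<in> {ts. sorted ts \<and> set ts \<subseteq> {s..t}}"
    using assms by simp
  from SUP_upper[OF this, where f = "\<lambda>ts. ereal (\<Sum>i<length ts - 1. norm (\<sigma> (ts ! Suc i) - \<sigma> (ts ! i)))"]
  show ?thesis
    by (simp add: curve_length_def)
qed

text \<open>A chord is no longer than its arc, and the length of the arc is the difference of the
  parameters.\<close>

lemma arclength_path_lipschitz:
  assumes "arclength_path Xvalid l \<sigma>"
  shows "1-lipschitz_on {0..l} \<sigma>"
proof (rule lipschitz_onI)
  have le: "dist (\<sigma> s) (\<sigma> t) \<le> t - s" if "0 \<le> s" "s \<le> t" "t \<le> l" for s t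
  proof -
    have "curve_length \<sigma> s t = ereal (t - s)"
      using assms that by (simp add: arclength_path_def)
    then show ?thesis
      using dist_le_curve_length[of s t \<sigma>] that by (simp add: dist_norm norm_minus_commute)
  qed
  fix x y :: real
  assume "x \<in> {0..l}" "y \<in> {0..l}"
  then show "dist (\<sigma> x) (\<sigma> y) \<le> 1 * dist x y"
    using le[of x y] le[of y x] by (cases "x \<le> y") (auto simp: dist_real_def dist_commute)
qed simp

lemma has_integral_inverse_increasing:
  fixes A a b :: real
  assumes "0 < A" "a \<le> b"
  shows "((\<lambda>x. 1 / (A + (x - a))) has_integral ln ((A + (b - a)) / A)) {a..b}"
proof -
  have "((\<lambda>x. 1 / (A + (x - a))) has_integral ln (A + (b - a)) - ln (A + (a - a))) {a..b}"
  proof (rule fundamental_theorem_of_calculus[OF \<open>a \<le> b\<close>])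
    fix x assume "x \<in> {a..b}"
    then have "0 < A + (x - a)"
      using assms by simp
    then show "((\<lambda>x. ln (A + (x - a))) has_vector_derivative 1 / (A + (x - a))) (at x within {a..b})"
      unfolding has_real_derivative_iff_has_vector_derivative[symmetric]
      by (auto intro!: derivative_eq_intros)
  qed
  moreover have "ln (A + (b - a)) - ln (A + (a - a)) = ln ((A + (b - a)) / A)"
    using assms by (simp add: ln_div)
  ultimately show ?thesis
    by simp
qed

text \<open>The reflection \<open>x \<mapsto> - x\<close> carries this to the increasing case on
  \<open>{- b..- a}\<close>.\<close>

lemma has_integral_inverse_decreasing:
  fixes B a b :: real
  assumes "0 < B" "a \<le> b"
  shows "((\<lambda>x. 1 / (B + (b - x))) has_integral ln ((B + (b - a)) / B)) {a..b}"
  using has_integral_reflect_lemma_real[OF has_integral_inverse_increasing[of B "- b" "- a"]] assms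
  by (simp del: has_integral_reflect_real)

text \<open>The bound for two consecutive sample points. It concerns only a positive 1-Lipschitz
  real function, so the path no longer appears.\<close>

lemma integral_inverse_lipschitz_ge:
  fixes f :: "real \<Rightarrow> real"
  assumes lip: "1-lipschitz_on {a..b} f" and pos: "\<And>x. x \<in> {a..b} \<Longrightarrow> 0 < f x" and "a \<le> b"
  shows "ln ((f a + f b + b - a)\<^sup>2 / (4 * f a * f b)) \<le> integral {a..b} (\<lambda>x. 1 / f x)"
proof -
  \<comment> \<open>The solution of \<open>f a + (x - a) = f b + (b - x)\<close>, where the two
    lines meet.\<close>
  define m where "m = (a + b + f b - f a) / 2"
  have lipD: "\<bar>f x - f y\<bar> \<le> \<bar>x - y\<bar>" if "x \<in> {a..b}" "y \<in> {a..b}" for x y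
    using lipschitz_onD[OF lip that] by (simp add: dist_real_def)
  \<comment> \<open>Both inequalities together say \<open>\<bar>f a - f b\<bar> \<le> b - a\<close>,
    which is the Lipschitz condition at the endpoints.\<close>
  have m: "a \<le> m" "m \<le> b"
    using lipD[of a b] \<open>a \<le> b\<close> by (auto simp: m_def)
  have fa: "0 < f a" and fb: "0 < f b"
    using pos \<open>a \<le> b\<close> by auto
  have cont: "continuous_on {a..b} (\<lambda>x. 1 / f x)"
    using lipschitz_on_continuous_on[OF lip] pos by (intro continuous_intros) force+
  have int: "(\<lambda>x. 1 / f x) integrable_on {c..d}" if "{c..d} \<subseteq> {a..b}" for c d
    using continuous_on_subset[OF cont that] by (rule integrable_continuous_real)
  have upper: "f x \<le> f a + (x - a)" "f x \<le> f b + (b - x)" if "x \<in> {a..b}" for x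
    using lipD[of x a] lipD[of x b] that by auto
  define h where "h = (f a + f b + b - a) / 2"
  have h: "f a + (m - a) = h" "f b + (b - m) = h" "0 < h"
    using fa fb \<open>a \<le> b\<close> by (auto simp: m_def h_def field_simps)
  have "ln (h / f a) \<le> integral {a..m} (\<lambda>x. 1 / f x)"
  proof (rule has_integral_le)
    show "((\<lambda>x. 1 / (f a + (x - a))) has_integral ln (h / f a)) {a..m}"
      using has_integral_inverse_increasing[OF fa m(1)] h by simp
    show "((\<lambda>x. 1 / f x) has_integral integral {a..m} (\<lambda>x. 1 / f x)) {a..m}"
      using int[of a m] m by (auto simp: integrable_integral)
    show "1 / (f a + (x - a)) \<le> 1 / f x" if "x \<in> {a..m}" for x
      using upper(1)[of x] pos[of x] that m by (intro divide_left_mono) auto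
  qed
  moreover have "ln (h / f b) \<le> integral {m..b} (\<lambda>x. 1 / f x)"
  proof (rule has_integral_le)
    show "((\<lambda>x. 1 / (f b + (b - x))) has_integral ln (h / f b)) {m..b}"
      using has_integral_inverse_decreasing[OF fb m(2)] h by simp
    show "((\<lambda>x. 1 / f x) has_integral integral {m..b} (\<lambda>x. 1 / f x)) {m..b}"
      using int[of m b] m by (auto simp: integrable_integral)
    show "1 / (f b + (b - x)) \<le> 1 / f x" if "x \<in> {m..b}" for x
      using upper(2)[of x] pos[of x] that m by (intro divide_left_mono) auto
  qed
  moreover have "ln ((f a + f b + b - a)\<^sup>2 / (4 * f a * f b)) = ln (h / f a) + ln (h / f b)"
  proof -
    \<comment> \<open>The 4 in the bound comes from squaring the 2 in the denominator of
      \<open>h\<close>.\<close>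
    have "(f a + f b + b - a)\<^sup>2 / (4 * f a * f b) = (h / f a) * (h / f b)"
      by (simp add: h_def power2_eq_square)
    then show ?thesis
      using h(3) fa fb by (simp only: ln_mult_pos divide_pos_pos)
  qed
  moreover have "integral {a..m} (\<lambda>x. 1 / f x) + integral {m..b} (\<lambda>x. 1 / f x) = integral {a..b} (\<lambda>x. 1 / f x)"
    using m int[of a b] by (intro Henstock_Kurzweil_Integration.integral_combine) auto
  ultimately show ?thesis
    by linarith
qed

text \<open>Steps are assumed only between \<open>i\<close> and \<open>j\<close>, since the sample
  points are constrained only for indices in \<open>{1..n}\<close>.\<close>

lemma le_of_steps_le:
  fixes t :: "nat \<Rightarrow> 'b::preorder"
  assumes "i \<le> j" "\<And>k. k \<in> {i..<j} \<Longrightarrow> t k \<le> t (Suc k)"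
  shows "t i \<le> t j"
  using assms
proof (induction j rule: dec_induct)
  case (step j)
  then have "t i \<le> t j" "t j \<le> t (Suc j)"
    by auto
  then show ?case
    by (rule order_trans)
qed simp

text \<open>Induction on the right end of the index range: each new interval is glued on by
  additivity of the integral.\<close>

lemma sum_integral_partition:
  fixes f :: "real \<Rightarrow> 'b::banach" and t :: "nat \<Rightarrow> real"
  assumes "m \<le> n" "\<And>i. i \<in> {m..<n} \<Longrightarrow> t i \<le> t (Suc i)" "f integrable_on {t m..t n}"
  shows "(\<Sum>i\<in>{m..<n}. integral {t i..t (Suc i)} f) = integral {t m..t n} f"
  using assms
proof (induction n rule: dec_induct)
  case base
  then show ?case by simp
next
  case (step n)
  have le: "t m \<le> t n"
    by (rule le_of_steps_le) (use step.hyps step.prems(1) in auto)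
  have last: "t n \<le> t (Suc n)"
    using step by simp
  \<comment> \<open>The induction hypothesis needs integrability on the shorter interval.\<close>
  have "f integrable_on {t m..t n}"
    using last by (intro integrable_on_subinterval[OF step.prems(2)]) auto
  then have "(\<Sum>i\<in>{m..<n}. integral {t i..t (Suc i)} f) = integral {t m..t n} f"
    using step by simp
  then show ?case
    using Henstock_Kurzweil_Integration.integral_combine[OF le last step.prems(2)] step.hyps by simp
qed

theorem corollary1:
  fixes X X_invalid X_valid :: "'a::real_normed_vector set"
    and \<sigma> :: "real \<Rightarrow> 'a" and l :: real
    and n :: nat and t \<delta> :: "nat \<Rightarrow> real"
  assumes "X_invalid \<subseteq> X" and "X_invalid \<noteq> {}"
    and "X_valid = X - X_invalid"
    and min_attained: "\<forall>x\<in>X_valid. \<exists>x'\<in>X_invalid. \<forall>y\<in>X_invalid. norm (x - x') \<le> norm (x - y)"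
    and clearance_pos: "\<forall>x\<in>X_valid. clearance X_invalid x > 0"
    and path: "arclength_path X_valid l \<sigma>"
    and "n \<ge> 1" and "t 1 = 0" and "t n = l"
    and "\<forall>i\<in>{1..<n}. t i < t (i + 1)"
    and "\<forall>i\<in>{1..n}. \<delta> i = clearance X_invalid (\<sigma> (t i))"
  shows "reciprocal_clearance_cost X_invalid l \<sigma>
           \<ge> (\<Sum>i\<in>{1..<n}. ln ((\<delta> i + \<delta> (i + 1) + t (i + 1) - t i)\<^sup>2 / (4 * \<delta> i * \<delta> (i + 1))))"
proof -
  define f where "f = (\<lambda>x. clearance X_invalid (\<sigma> x))"
  have lip: "1-lipschitz_on {0..l} f"
    using lipschitz_on_compose2[OF arclength_path_lipschitz[OF path] clearance_lipschitz[OF assms(2)]]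
    by (simp add: f_def)
  have pos: "0 < f x" if "x \<in> {0..l}" for x
    using path clearance_pos that by (simp add: f_def arclength_path_def image_subset_iff)
  \<comment> \<open>As \<open>integral\<close> defaults to 0 for non-integrable functions,
    integrability must be known before the cost can be split. It follows from continuity and
    positivity of \<open>f\<close>.\<close>
  have int: "(\<lambda>x. 1 / f x) integrable_on {0..l}"
    using lipschitz_on_continuous_on[OF lip] pos
    by (intro integrable_continuous_real continuous_intros) force+
  have step: "t i < t (Suc i)" if "i \<in> {1..<n}" for i
    using assms(10) that by simp
  have mono: "t i \<le> t j" if "1 \<le> i" "i \<le> j" "j \<le> n" for i j
    by (rule le_of_steps_le) (use step that in \<open>auto intro: less_imp_le\<close>)
  have "(\<Sum>i\<in>{1..<n}. ln ((\<delta> i + \<delta> (i + 1) + t (i + 1) - t i)\<^sup>2 / (4 * \<delta> i * \<delta> (i + 1))))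
      \<le> (\<Sum>i\<in>{1..<n}. integral {t i..t (Suc i)} (\<lambda>x. 1 / f x))"
  proof (rule sum_mono)
    fix i assume i: "i \<in> {1..<n}"
    have sub: "{t i..t (Suc i)} \<subseteq> {0..l}"
      using mono[of 1 i] mono[of "Suc i" n] i assms(8,9) by auto
    \<comment> \<open>From \<open>i < n\<close> the index \<open>i + 1\<close> is still at most
      \<open>n\<close>, so both values of \<open>\<delta>\<close> are clearances.\<close>
    have "\<delta> i = f (t i)" "\<delta> (i + 1) = f (t (Suc i))"
      using assms(11) i by (auto simp: f_def)
    then show "ln ((\<delta> i + \<delta> (i + 1) + t (i + 1) - t i)\<^sup>2 / (4 * \<delta> i * \<delta> (i + 1)))
        \<le> integral {t i..t (Suc i)} (\<lambda>x. 1 / f x)"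
      using integral_inverse_lipschitz_ge[OF lipschitz_on_subset[OF lip sub]] pos sub step[OF i]
      by (simp add: subset_iff)
  qed
  \<comment> \<open>For \<open>n = 1\<close> the sum is empty and the integral is over a single
    point.\<close>
  also have "\<dots> = integral {t 1..t n} (\<lambda>x. 1 / f x)"
    using assms(7-9) step int by (intro sum_integral_partition) (auto intro: less_imp_le)
  finally show ?thesis
    using assms(8,9) by (simp add: reciprocal_clearance_cost_def f_def)
qed

end
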